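(* Let $(A,\cdot,\alpha)$ be a Hom-pre-Malcev algebra, $(V,\ell,r,\beta)$ a representation of $A$, and $T:V\to A$ an $\mathcal{O}$-operator of $(A,\cdot,\alpha)$ associated to $(V,\ell,r,\beta)$. Then $(V,\blacktriangleright,\blacktriangleleft,\beta)$ is a Hom-M-dendriform algebra, where for all $a,b\in V$ $$a\blacktriangleright b=r(T(b))a,\qquad a\blacktriangleleft b=\ell(T(a))b.$$ Therefore $a\cdot_V b=a\blacktriangleleft b+a\blacktriangleright b$ defines a Hom-pre-Malcev algebra $(V,\cdot_V,\beta)$ (the associated horizontal Hom-pre-Malcev algebra), and $T$ is a morphism of Hom-pre-Malcev algebras from $(V,\cdot_V,\beta)$ to $(A,\cdot,\alpha)$. Moreover, $T(V)=\{T(v)\mid v\in V\}\subseteq A$ is a Hom-pre-Malcev subalgebra of $(A,\cdot,\alpha)$, and there is an induced Hom-M-dendriform algebra structure $(T(V),\triangleright,\triangleleft,\alpha)$ on $T(V)$ given for all $a,b\in V$ by $$T(a)\triangleright T(b)=T(a\blacktriangleright b),\qquad T(a)\triangleleft T(b)=T(a\blacktriangleleft b).$$ Its associated horizontal Hom-pre-Malcev structure on $T(V)$ (with product $u\triangleleft v+u\triangleright v$) is just the subalgebra structure inherited from $(A,\cdot,\alpha)$, and $T$ is a homomorphism of Hom-M-dendriform algebras from $(V,\blacktriangleright,\blacktriangleleft,\beta)$ to $(T(V),\triangleright,\triangleleft,\alpha)$.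
   Context: All vector spaces are over a field $\mathbb{K}$ of characteristic $0$. A Hom-pre-Malcev algebra is a triple $(A,\cdot,\alpha)$ consisting of a vector space $A$, a bilinear product $\cdot:A\times A\to A$ and a linear map $\alpha:A\to A$ such that for all $x,y,z,t\in A$, with $[x,y]=x\cdot y-y\cdot x$, $$\alpha([y,z])\cdot\alpha(x\cdot t)+[[x,y],\alpha(z)]\cdot\alpha^2(t)+\alpha^2(y)\cdot([x,z]\cdot\alpha(t))-\alpha^2(x)\cdot(\alpha(y)\cdot(z\cdot t))+\alpha^2(z)\cdot(\alpha(x)\cdot(y\cdot t))=0.$$ A morphism of Hom-pre-Malcev algebras $(A,\cdot,\alpha)\to(A',\cdot',\alpha')$ is a linear map $f$ with $f(x\cdot y)=f(x)\cdot' f(y)$ and $f\alpha=\alpha' f$. A representation of $(A,\cdot,\alpha)$ is a quadruple $(V,\ell,r,\beta)$, where $V$ is a vector space, $\beta\in \mathrm{End}(V)$ and $\ell,r:A\to \mathrm{End}(V)$ are linear maps such that, with $\rho=\ell-r$, for all $x,y,z\in A$: $$\ell(\alpha(x))\beta=\beta\ell(x),\qquad r(\alpha(x))\beta=\beta r(x),$$ $$\ell([[x,y],\alpha(z)])\beta^2=\ell(\alpha^2(x))\ell(\alpha(y))\ell(z)-\ell(\alpha^2(z))\ell(\alpha(x))\ell(y)+\ell(\alpha^2(y))\ell([z,x])\beta-\ell(\alpha([y,z]))\ell(\alpha(x))\beta,$$ $$r(\alpha^2(x))\rho(\alpha(y))\rho(z)-r(\alpha(z)\cdot(y\cdot x))\beta^2+\ell(\alpha^2(y))r(z\cdot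 x)\beta+\ell(\alpha([z,y]))r(\alpha(x))\beta-\ell(\alpha^2(z))r(\alpha(x))\rho(y)=0,$$ $$\ell(\alpha^2(y))\ell(\alpha(z))r(x)-r(\alpha^2(x))\rho(\alpha(y))\rho(z)-\ell(\alpha^2(z))r(y\cdot x)\beta-r(\alpha(z\cdot x))\rho(\alpha(y))\beta+r([z,y]\cdot\alpha(x))\beta^2=0,$$ $$r(\alpha(y)\cdot(z\cdot x))\beta^2+r(\alpha^2(x))\rho([y,z])\beta-\ell(\alpha^2(y))\ell(\alpha(z))r(x)+r(\alpha(y\cdot x))\rho(\alpha(z))\beta+\ell(\alpha^2(z))r(\alpha(x))\rho(y)=0.$$ An $\mathcal{O}$-operator of $(A,\cdot,\alpha)$ associated to $(V,\ell,r,\beta)$ is a linear map $T:V\to A$ with $T\circ\beta=\alpha\circ T$ and $T(a)\cdot T(b)=T\big(\ell(T(a))b+r(T(b))a\big)$ for all $a,b\in V$. A Hom-M-dendriform algebra $(A,\blacktriangleright,\blacktriangleleft,\alpha)$ is a vector space $A$ with two bilinear products $\blacktriangleright,\blacktriangleleft:A\times A\to A$ and a linear map $\alpha:A\to A$ such that, writing $x\cdot y=x\blacktriangleleft y+x\blacktriangleright y$, $x\diamond y=x\blacktriangleleft y-y\blacktriangleright x$, $[x,y]=x\cdot y-y\cdot x=x\diamond y-y\diamond x$, for all $x,y,z,t\in A$: $$(\alpha(z)\diamond(y\diamond x))\blacktriangleright\alpha^2(t)-\alpha^2(x)\blacktriangleright(\alpha(y)\cdot(z\cdot t))+\alpha^2(z)\blacktriangleleft(\alpha(x)\blacktriangleright(y\cdot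 t))+\alpha([y,z])\blacktriangleleft\alpha(x\blacktriangleright t)-\alpha^2(y)\blacktriangleleft((z\diamond x)\blacktriangleright\alpha(t))=0,$$ $$\alpha^2(z)\blacktriangleleft(\alpha(x)\blacktriangleleft(y\blacktriangleright t))-(\alpha(z)\diamond(x\diamond y))\blacktriangleright\alpha^2(t)-\alpha^2(x)\blacktriangleleft(\alpha(y)\blacktriangleright(z\cdot t))-\alpha(z\diamond y)\blacktriangleright\alpha(x\cdot t)+\alpha^2(y)\blacktriangleright([x,z]\cdot\alpha(t))=0,$$ $$\alpha^2(z)\blacktriangleright(\alpha(x)\cdot(y\cdot t))+([x,y]\diamond\alpha(z))\blacktriangleright\alpha^2(t)-\alpha^2(x)\blacktriangleleft(\alpha(y)\blacktriangleleft(z\blacktriangleright t))+\alpha(y\diamond z)\blacktriangleright\alpha(x\cdot t)+\alpha^2(y)\blacktriangleleft((x\diamond z)\blacktriangleright\alpha(t))=0,$$ $$[[x,y],\alpha(z)]\blacktriangleleft\alpha^2(t)-\alpha^2(x)\blacktriangleleft(\alpha(y)\blacktriangleleft(z\blacktriangleleft t))+\alpha^2(z)\blacktriangleleft(\alpha(x)\blacktriangleleft(y\blacktriangleleft t))+\alpha([y,z])\blacktriangleleft\alpha(x\blacktriangleleft t)+\alpha^2(y)\blacktriangleleft([x,z]\blacktriangleleft\alpha(t))=0.$$ A homomorphism of Hom-M-dendriform algebras is a linear map preserving both products and commuting with the structure maps. *)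

theory Defs
  imports Complex_Main "HOL-Library.FuncSet"
begin

text \<open>
  All structures live on a linear subspace \<^term>\<open>A\<close> of an ambient vector space, since
  the image of an operator \<open>T\<close> has to be an algebra in its own right. The operations are total
  functions on the ambient type, but only their values on the carrier matter. An algebra
  on a whole type is the case \<^term>\<open>A = UNIV\<close>.
\<close>

locale vector_space_on = vector_space scale
  for scale :: "'k::field \<Rightarrow> 'a::ab_group_add \<Rightarrow> 'a" +
  fixes A :: "'a set"
  assumes subspace_carrier: "subspace A"

definition linear_on ::
  "('k::field \<Rightarrow> 'a::ab_group_add \<Rightarrow> 'a) \<Rightarrow> 'a set \<Rightarrow>
   ('k \<Rightarrow> 'b::ab_group_add \<Rightarrow> 'b) \<Rightarrow> 'b set \<Rightarrow> ('a \<Rightarrow> 'b) \<Rightarrow> bool"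
  where "linear_on sA A sB B f \<longleftrightarrow>
    f \<in> A \<rightarrow> B \<and>
    (\<forall>x\<in>A. \<forall>y\<in>A. f (x + y) = f x + f y) \<and>
    (\<forall>c. \<forall>x\<in>A. f (sA c x) = sB c (f x))"

lemma linear_on_UNIV:
  assumes "vector_space sA" and "vector_space sB"
  shows "linear_on sA UNIV sB UNIV f \<longleftrightarrow> Vector_Spaces.linear sA sB f"
  using assms
  by (auto simp: linear_on_def Vector_Spaces.linear_def module_hom_def module_hom_axioms_def
      module_iff_vector_space)

definition bilinear_on ::
  "('k::field \<Rightarrow> 'a::ab_group_add \<Rightarrow> 'a) \<Rightarrow> 'a set \<Rightarrow>
   ('k \<Rightarrow> 'b::ab_group_add \<Rightarrow> 'b) \<Rightarrow> 'b set \<Rightarrow>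
   ('k \<Rightarrow> 'c::ab_group_add \<Rightarrow> 'c) \<Rightarrow> 'c set \<Rightarrow> ('a \<Rightarrow> 'b \<Rightarrow> 'c) \<Rightarrow> bool"
  where "bilinear_on sA A sB B sC C f \<longleftrightarrow>
    (\<forall>x\<in>A. linear_on sB B sC C (f x)) \<and>
    (\<forall>y\<in>B. linear_on sA A sC C (\<lambda>x. f x y))"

locale hom_algebra = vector_space_on scale A
  for scale :: "'k::field \<Rightarrow> 'a::ab_group_add \<Rightarrow> 'a" and A :: "'a set" +
  fixes mul :: "'a \<Rightarrow> 'a \<Rightarrow> 'a"  (infixl "\<cdot>" 70)
    and \<alpha> :: "'a \<Rightarrow> 'a"
  assumes bilinear_mul: "bilinear_on scale A scale A scale A (\<cdot>)"
    and linear_twist: "linear_on scale A scale A \<alpha>"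
begin

definition bracket :: "'a \<Rightarrow> 'a \<Rightarrow> 'a"  ("\<langle>_, _\<rangle>")
  where "\<langle>x, y\<rangle> = x \<cdot> y - y \<cdot> x"

end

locale hom_pre_malcev = hom_algebra +
  assumes hom_pre_malcev_identity:
    "\<lbrakk>x \<in> A; y \<in> A; z \<in> A; t \<in> A\<rbrakk> \<Longrightarrow>
      \<alpha> \<langle>y, z\<rangle> \<cdot> \<alpha> (x \<cdot> t) + \<langle>\<langle>x, y\<rangle>, \<alpha> z\<rangle> \<cdot> \<alpha> (\<alpha> t)
      + \<alpha> (\<alpha> y) \<cdot> (\<langle>x, z\<rangle> \<cdot> \<alpha> t) - \<alpha> (\<alpha> x) \<cdot> (\<alpha> y \<cdot> (z \<cdot> t))
      + \<alpha> (\<alpha> z) \<cdot> (\<alpha> x \<cdot> (y \<cdot> t)) = 0"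

locale hom_pre_malcev_morphism =
  source: hom_pre_malcev sA A mulA \<alpha> + target: hom_pre_malcev sB B mulB \<beta>
  for sA :: "'k::field \<Rightarrow> 'a::ab_group_add \<Rightarrow> 'a" and A mulA \<alpha>
    and sB :: "'k \<Rightarrow> 'b::ab_group_add \<Rightarrow> 'b" and B mulB \<beta> +
  fixes f :: "'a \<Rightarrow> 'b"
  assumes linear: "linear_on sA A sB B f"
    and mul: "\<lbrakk>x \<in> A; y \<in> A\<rbrakk> \<Longrightarrow> f (mulA x y) = mulB (f x) (f y)"
    and twist: "x \<in> A \<Longrightarrow> f (\<alpha> x) = \<beta> (f x)"

locale hom_pre_malcev_subalgebra = hom_pre_malcev scale A mul \<alpha>
  for scale :: "'k::field \<Rightarrow> 'a::ab_group_add \<Rightarrow> 'a" and A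
    and mul :: "'a \<Rightarrow> 'a \<Rightarrow> 'a"  (infixl "\<cdot>" 70) and \<alpha> +
  fixes S :: "'a set"
  assumes subset_carrier: "S \<subseteq> A"
    and subspace_subalgebra: "subspace S"
    and mul_closed: "\<lbrakk>x \<in> S; y \<in> S\<rbrakk> \<Longrightarrow> x \<cdot> y \<in> S"
    and twist_closed: "x \<in> S \<Longrightarrow> \<alpha> x \<in> S"

locale two_actions =
  fixes l r :: "'a \<Rightarrow> 'v \<Rightarrow> 'v::ab_group_add"
begin

definition \<rho> :: "'a \<Rightarrow> 'v \<Rightarrow> 'v"
  where "\<rho> x v = l x v - r x v"

end

text \<open>
  A linear map from \<^term>\<open>A\<close> to \<open>End(V)\<close> is encoded as a bilinear map from \<open>A \<times> V\<close> to \<open>V\<close>,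
  and identities in \<open>End(V)\<close> are written pointwise on \<^term>\<open>V\<close>.
\<close>

locale hom_pre_malcev_representation =
  hom_pre_malcev sA A mul \<alpha> + V: vector_space_on sV V + two_actions l r
  for sA :: "'k::field \<Rightarrow> 'a::ab_group_add \<Rightarrow> 'a" and A
    and mul :: "'a \<Rightarrow> 'a \<Rightarrow> 'a"  (infixl "\<cdot>" 70) and \<alpha>
    and sV :: "'k \<Rightarrow> 'v::ab_group_add \<Rightarrow> 'v" and V
    and l r :: "'a \<Rightarrow> 'v \<Rightarrow> 'v" +
  fixes \<beta> :: "'v \<Rightarrow> 'v"
  assumes bilinear_l: "bilinear_on sA A sV V sV V l"
    and bilinear_r: "bilinear_on sA A sV V sV V r"
    and linear_beta: "linear_on sV V sV V \<beta>"
    and l_twist: "\<lbrakk>x \<in> A; v \<in> V\<rbrakk> \<Longrightarrow> l (\<alpha> x) (\<beta> v) = \<beta> (l x v)"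
    and r_twist: "\<lbrakk>x \<in> A; v \<in> V\<rbrakk> \<Longrightarrow> r (\<alpha> x) (\<beta> v) = \<beta> (r x v)"
    and representation_l:
      "\<lbrakk>x \<in> A; y \<in> A; z \<in> A; v \<in> V\<rbrakk> \<Longrightarrow>
        l \<langle>\<langle>x, y\<rangle>, \<alpha> z\<rangle> (\<beta> (\<beta> v)) =
          l (\<alpha> (\<alpha> x)) (l (\<alpha> y) (l z v)) - l (\<alpha> (\<alpha> z)) (l (\<alpha> x) (l y v))
          + l (\<alpha> (\<alpha> y)) (l \<langle>z, x\<rangle> (\<beta> v)) - l (\<alpha> \<langle>y, z\<rangle>) (l (\<alpha> x) (\<beta> v))"
    and representation_r1:
      "\<lbrakk>x \<in> A; y \<in> A; z \<in> A; v \<in> V\<rbrakk> \<Longrightarrow>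
        r (\<alpha> (\<alpha> x)) (\<rho> (\<alpha> y) (\<rho> z v)) - r (\<alpha> z \<cdot> (y \<cdot> x)) (\<beta> (\<beta> v))
        + l (\<alpha> (\<alpha> y)) (r (z \<cdot> x) (\<beta> v)) + l (\<alpha> \<langle>z, y\<rangle>) (r (\<alpha> x) (\<beta> v))
        - l (\<alpha> (\<alpha> z)) (r (\<alpha> x) (\<rho> y v)) = 0"
    and representation_r2:
      "\<lbrakk>x \<in> A; y \<in> A; z \<in> A; v \<in> V\<rbrakk> \<Longrightarrow>
        l (\<alpha> (\<alpha> y)) (l (\<alpha> z) (r x v)) - r (\<alpha> (\<alpha> x)) (\<rho> (\<alpha> y) (\<rho> z v))
        - l (\<alpha> (\<alpha> z)) (r (y \<cdot> x) (\<beta> v)) - r (\<alpha> (z \<cdot> x)) (\<rho> (\<alpha> y) (\<beta> v))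
        + r (\<langle>z, y\<rangle> \<cdot> \<alpha> x) (\<beta> (\<beta> v)) = 0"
    and representation_r3:
      "\<lbrakk>x \<in> A; y \<in> A; z \<in> A; v \<in> V\<rbrakk> \<Longrightarrow>
        r (\<alpha> y \<cdot> (z \<cdot> x)) (\<beta> (\<beta> v)) + r (\<alpha> (\<alpha> x)) (\<rho> \<langle>y, z\<rangle> (\<beta> v))
        - l (\<alpha> (\<alpha> y)) (l (\<alpha> z) (r x v)) + r (\<alpha> (y \<cdot> x)) (\<rho> (\<alpha> z) (\<beta> v))
        + l (\<alpha> (\<alpha> z)) (r (\<alpha> x) (\<rho> y v)) = 0"

locale hom_O_operator = hom_pre_malcev_representation sA A mul \<alpha> sV V l r \<beta>
  for sA :: "'k::field \<Rightarrow> 'a::ab_group_add \<Rightarrow> 'a" and A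
    and mul :: "'a \<Rightarrow> 'a \<Rightarrow> 'a"  (infixl "\<cdot>" 70) and \<alpha>
    and sV :: "'k \<Rightarrow> 'v::ab_group_add \<Rightarrow> 'v" and V l r \<beta> +
  fixes T :: "'v \<Rightarrow> 'a"
  assumes linear_T: "linear_on sV V sA A T"
    and T_twist: "a \<in> V \<Longrightarrow> T (\<beta> a) = \<alpha> (T a)"
    and T_mul: "\<lbrakk>a \<in> V; b \<in> V\<rbrakk> \<Longrightarrow> T a \<cdot> T b = T (l (T a) b + r (T b) a)"

definition horizontal :: "('a \<Rightarrow> 'a \<Rightarrow> 'a) \<Rightarrow> ('a \<Rightarrow> 'a \<Rightarrow> 'a) \<Rightarrow> 'a \<Rightarrow> 'a \<Rightarrow> 'a::ab_group_add"
  where "horizontal rt lt x y = lt x y + rt x y"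

locale two_products =
  fixes rt :: "'a \<Rightarrow> 'a \<Rightarrow> 'a::ab_group_add"  (infixl "\<triangleright>" 70)
    and lt :: "'a \<Rightarrow> 'a \<Rightarrow> 'a"  (infixl "\<triangleleft>" 70)
begin

abbreviation horizontal_mul  (infixl "\<cdot>" 70)
  where "x \<cdot> y \<equiv> horizontal (\<triangleright>) (\<triangleleft>) x y"

definition diamond_mul  (infixl "\<diamondop>" 70)
  where "x \<diamondop> y = x \<triangleleft> y - y \<triangleright> x"

definition bracket  ("\<langle>_, _\<rangle>")
  where "\<langle>x, y\<rangle> = x \<cdot> y - y \<cdot> x"

end

locale hom_M_dendriform = vector_space_on scale A + two_products rt lt
  for scale :: "'k::field \<Rightarrow> 'a::ab_group_add \<Rightarrow> 'a" and A :: "'a set"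
    and rt :: "'a \<Rightarrow> 'a \<Rightarrow> 'a"  (infixl "\<triangleright>" 70)
    and lt :: "'a \<Rightarrow> 'a \<Rightarrow> 'a"  (infixl "\<triangleleft>" 70) +
  fixes \<alpha> :: "'a \<Rightarrow> 'a"
  assumes bilinear_rt: "bilinear_on scale A scale A scale A (\<triangleright>)"
    and bilinear_lt: "bilinear_on scale A scale A scale A (\<triangleleft>)"
    and linear_twist: "linear_on scale A scale A \<alpha>"
    and M_dendriform1:
      "\<lbrakk>x \<in> A; y \<in> A; z \<in> A; t \<in> A\<rbrakk> \<Longrightarrow>
        (\<alpha> z \<diamondop> (y \<diamondop> x)) \<triangleright> \<alpha> (\<alpha> t) - \<alpha> (\<alpha> x) \<triangleright> (\<alpha> y \<cdot> (z \<cdot> t))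
        + \<alpha> (\<alpha> z) \<triangleleft> (\<alpha> x \<triangleright> (y \<cdot> t)) + \<alpha> \<langle>y, z\<rangle> \<triangleleft> \<alpha> (x \<triangleright> t)
        - \<alpha> (\<alpha> y) \<triangleleft> ((z \<diamondop> x) \<triangleright> \<alpha> t) = 0"
    and M_dendriform2:
      "\<lbrakk>x \<in> A; y \<in> A; z \<in> A; t \<in> A\<rbrakk> \<Longrightarrow>
        \<alpha> (\<alpha> z) \<triangleleft> (\<alpha> x \<triangleleft> (y \<triangleright> t)) - (\<alpha> z \<diamondop> (x \<diamondop> y)) \<triangleright> \<alpha> (\<alpha> t)
        - \<alpha> (\<alpha> x) \<triangleleft> (\<alpha> y \<triangleright> (z \<cdot> t)) - \<alpha> (z \<diamondop> y) \<triangleright> \<alpha> (x \<cdot> t)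
        + \<alpha> (\<alpha> y) \<triangleright> (\<langle>x, z\<rangle> \<cdot> \<alpha> t) = 0"
    and M_dendriform3:
      "\<lbrakk>x \<in> A; y \<in> A; z \<in> A; t \<in> A\<rbrakk> \<Longrightarrow>
        \<alpha> (\<alpha> z) \<triangleright> (\<alpha> x \<cdot> (y \<cdot> t)) + (\<langle>x, y\<rangle> \<diamondop> \<alpha> z) \<triangleright> \<alpha> (\<alpha> t)
        - \<alpha> (\<alpha> x) \<triangleleft> (\<alpha> y \<triangleleft> (z \<triangleright> t)) + \<alpha> (y \<diamondop> z) \<triangleright> \<alpha> (x \<cdot> t)
        + \<alpha> (\<alpha> y) \<triangleleft> ((x \<diamondop> z) \<triangleright> \<alpha> t) = 0"
    and M_dendriform4:
      "\<lbrakk>x \<in> A; y \<in> A; z \<in> A; t \<in> A\<rbrakk> \<Longrightarrow>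
        \<langle>\<langle>x, y\<rangle>, \<alpha> z\<rangle> \<triangleleft> \<alpha> (\<alpha> t) - \<alpha> (\<alpha> x) \<triangleleft> (\<alpha> y \<triangleleft> (z \<triangleleft> t))
        + \<alpha> (\<alpha> z) \<triangleleft> (\<alpha> x \<triangleleft> (y \<triangleleft> t)) + \<alpha> \<langle>y, z\<rangle> \<triangleleft> \<alpha> (x \<triangleleft> t)
        + \<alpha> (\<alpha> y) \<triangleleft> (\<langle>x, z\<rangle> \<triangleleft> \<alpha> t) = 0"

locale hom_M_dendriform_morphism =
  source: hom_M_dendriform sA A rtA ltA \<alpha> + target: hom_M_dendriform sB B rtB ltB \<beta>
  for sA :: "'k::field \<Rightarrow> 'a::ab_group_add \<Rightarrow> 'a" and A rtA ltA \<alpha>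
    and sB :: "'k \<Rightarrow> 'b::ab_group_add \<Rightarrow> 'b" and B rtB ltB \<beta> +
  fixes f :: "'a \<Rightarrow> 'b"
  assumes linear: "linear_on sA A sB B f"
    and rt: "\<lbrakk>x \<in> A; y \<in> A\<rbrakk> \<Longrightarrow> f (rtA x y) = rtB (f x) (f y)"
    and lt: "\<lbrakk>x \<in> A; y \<in> A\<rbrakk> \<Longrightarrow> f (ltA x y) = ltB (f x) (f y)"
    and twist: "x \<in> A \<Longrightarrow> f (\<alpha> x) = \<beta> (f x)"

end

theory Submission
  imports Defs
begin

text \<open>
  Every product on \<open>V\<close> is an action of a value of \<open>T\<close>: \<open>a \<triangleleft> b = l (T a) b\<close>, \<open>b \<triangleright> a = r (T a) b\<close>, and
  hence \<open>a \<diamondop> b = \<rho> (T a) b\<close>. The O-operator identity says that \<open>T\<close> turns the horizontal product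
  \<open>a \<triangleleft> b + a \<triangleright> b\<close> into the product of \<open>A\<close>, and so brackets into brackets. With this
  dictionary the four dendriform identities on \<open>V\<close> are the four representation identities,
  evaluated at values of \<open>T\<close> (\<open>hom_M_dendriform_V\<close>).

  In a dendriform identity, three of the arguments act on the fourth. The Hom-pre-Malcev expression
  of a horizontal product is multilinear in four arguments, and expanding it sorts its terms by which
  argument is acted on; the four groups are the four dendriform identities. So the horizontal
  product of any Hom-M-dendriform algebra is Hom-pre-Malcev (\<open>hom_pre_malcev_horizontal\<close>).

  The products descend to \<open>T(V)\<close> because the kernel of \<open>T\<close> is an ideal for both of them: if
  \<open>T a = 0\<close>, then one of the two summands in \<open>T a \<cdot> T b = T (a \<triangleleft> b) + T (a \<triangleright> b)\<close> is zero because
  \<open>l\<close> is linear in \<open>T a\<close>, and the left side is zero, so the other summand is zero too; likewise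
  for \<open>T b = 0\<close> (\<open>T_rtV_cong\<close>, \<open>T_ltV_cong\<close>). The identities then pass to the image
  (\<open>hom_M_dendriform_image\<close>), and the horizontal product of the image is that of \<open>A\<close>, again by the
  O-operator identity.
\<close>

section \<open>Linear maps on subspaces\<close>

context
  fixes sA :: "'k::field \<Rightarrow> 'a::ab_group_add \<Rightarrow> 'a" and A
    and sB :: "'k \<Rightarrow> 'b::ab_group_add \<Rightarrow> 'b" and B f
  assumes linear: "linear_on sA A sB B f"
begin

lemma linear_on_closed: "x \<in> A \<Longrightarrow> f x \<in> B"
  and linear_on_add: "x \<in> A \<Longrightarrow> y \<in> A \<Longrightarrow> f (x + y) = f x + f y"
  and linear_on_scale: "x \<in> A \<Longrightarrow> f (sA c x) = sB c (f x)"
  using linear by (auto simp: linear_on_def)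

lemma linear_on_zero: "0 \<in> A \<Longrightarrow> f 0 = 0"
  using linear_on_add[of 0 0] by simp

lemma linear_on_diff:
  assumes "vector_space_on sA A" "x \<in> A" "y \<in> A"
  shows "f (x - y) = f x - f y"
proof -
  interpret vector_space_on sA A by fact
  have "x - y \<in> A"
    using assms subspace_carrier by (blast intro: subspace_diff)
  from linear_on_add[OF this \<open>y \<in> A\<close>] show ?thesis
    by (simp add: algebra_simps)
qed

lemma linear_on_subspace_image:
  assumes "vector_space_on sA A" "vector_space sB"
  shows "vector_space_on sB (f ` A)"
proof -
  interpret A: vector_space_on sA A by fact
  interpret B: vector_space sB by fact
  note sub = A.subspace_carrier
  show ?thesis
  proof
    show "B.subspace (f ` A)"
    proof (rule B.subspaceI)
      show "0 \<in> f ` A"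
        using A.subspace_0[OF sub] linear_on_zero by force
    next
      fix u v assume "u \<in> f ` A" "v \<in> f ` A"
      then show "u + v \<in> f ` A"
        using A.subspace_add[OF sub] linear_on_add by (metis (no_types, lifting) imageE imageI)
    next
      fix c u assume "u \<in> f ` A"
      then show "sB c u \<in> f ` A"
        using A.subspace_scale[OF sub] linear_on_scale by (metis (no_types, lifting) imageE imageI)
    qed
  qed
qed

end

text \<open>
  Pushing an endomorphism or a product forward along a linear map preserves linearity: a relation
  of linearity between elements of the image is the image of the same relation between preimages.
\<close>

lemma linear_on_image:
  assumes "vector_space_on sA A" and f: "linear_on sA A sB B f" and g: "linear_on sA A sA A g"
    and intertwine: "\<And>x. x \<in> A \<Longrightarrow> g' (f x) = f (g x)"
  shows "linear_on sB (f ` A) sB (f ` A) g'"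
proof -
  interpret vector_space_on sA A by fact
  have add: "x + y \<in> A" and scale: "sA c x \<in> A" if "x \<in> A" "y \<in> A" for x y c
    using that subspace_carrier by (auto intro: subspace_add subspace_scale)
  have "g' (f x + f y) = g' (f x) + g' (f y)" if "x \<in> A" "y \<in> A" for x y
    using that intertwine[of "x + y"] intertwine[of x] intertwine[of y]
    by (simp add: add linear_on_add[OF f] linear_on_add[OF g] linear_on_closed[OF g])
  moreover have "g' (sB c (f x)) = sB c (g' (f x))" if "x \<in> A" for x c
    using that intertwine[of "sA c x"] intertwine[of x]
    by (simp add: scale linear_on_scale[OF f] linear_on_scale[OF g] linear_on_closed[OF g])
  ultimately show ?thesis
    using linear_on_closed[OF g] intertwine by (auto simp: linear_on_def)
qed

lemma bilinear_on_image:
  assumes "vector_space_on sA A" "linear_on sA A sB B f" "bilinear_on sA A sA A sA A m"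
    and "\<And>x y. x \<in> A \<Longrightarrow> y \<in> A \<Longrightarrow> m' (f x) (f y) = f (m x y)"
  shows "bilinear_on sB (f ` A) sB (f ` A) sB (f ` A) m'"
  using assms
  by (auto simp: bilinear_on_def
      intro: linear_on_image[where g = "m x" for x] linear_on_image[where g = "\<lambda>x. m x y" for y])

section \<open>From Hom-M-dendriform to Hom-pre-Malcev algebras\<close>

context hom_M_dendriform
begin

lemma add_closed: "x \<in> A \<Longrightarrow> y \<in> A \<Longrightarrow> x + y \<in> A"
  and diff_closed: "x \<in> A \<Longrightarrow> y \<in> A \<Longrightarrow> x - y \<in> A"
  using subspace_carrier by (auto intro: subspace_add subspace_diff)

lemma vector_space_on_carrier: "vector_space_on scale A"
  by unfold_locales

lemma linear_rt: "x \<in> A \<Longrightarrow> linear_on scale A scale A ((\<triangleright>) x)"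
    "y \<in> A \<Longrightarrow> linear_on scale A scale A (\<lambda>x. x \<triangleright> y)"
  and linear_lt: "x \<in> A \<Longrightarrow> linear_on scale A scale A ((\<triangleleft>) x)"
    "y \<in> A \<Longrightarrow> linear_on scale A scale A (\<lambda>x. x \<triangleleft> y)"
  using bilinear_rt bilinear_lt by (auto simp: bilinear_on_def)

lemma products_closed:
  assumes "x \<in> A" "y \<in> A"
  shows "x \<triangleright> y \<in> A" "x \<triangleleft> y \<in> A" "x \<cdot> y \<in> A" "x \<diamondop> y \<in> A" "\<langle>x, y\<rangle> \<in> A"
  using assms linear_on_closed[OF linear_rt(1)] linear_on_closed[OF linear_lt(1)]
  by (auto simp: horizontal_def diamond_mul_def bracket_def intro!: add_closed diff_closed)

lemmas closed = add_closed diff_closed products_closed linear_on_closed[OF linear_twist]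

lemmas products_add =
  linear_on_add[OF linear_rt(1)] linear_on_add[OF linear_rt(2)]
  linear_on_add[OF linear_lt(1)] linear_on_add[OF linear_lt(2)]

lemmas products_diff =
  linear_on_diff[OF linear_rt(1) vector_space_on_carrier]
  linear_on_diff[OF linear_rt(2) vector_space_on_carrier]
  linear_on_diff[OF linear_lt(1) vector_space_on_carrier]
  linear_on_diff[OF linear_lt(2) vector_space_on_carrier]

lemma diamond_diff:
  assumes "x \<in> A" "y \<in> A" "z \<in> A"
  shows "x \<diamondop> (y - z) = x \<diamondop> y - x \<diamondop> z"
  using assms by (simp add: diamond_mul_def products_diff algebra_simps)

text \<open>
  In \<open>x \<diamondop> y\<close> the left factor acts on the right one, so this splits a bracket into a part where \<open>y\<close>
  is acted on and a part where \<open>x\<close> is.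
\<close>

lemma bracket_diamond: "\<langle>x, y\<rangle> = x \<diamondop> y - y \<diamondop> x"
  by (simp add: bracket_def diamond_mul_def horizontal_def)

lemma bilinear_horizontal: "bilinear_on scale A scale A scale A (horizontal (\<triangleright>) (\<triangleleft>))"
  using linear_rt linear_lt
  by (auto simp: bilinear_on_def linear_on_def horizontal_def scale_right_distrib Pi_iff
      intro!: add_closed)

text \<open>
  A left factor of \<open>\<triangleleft>\<close> or \<open>\<diamondop>\<close>, or a right factor of \<open>\<triangleright>\<close>, acts on the other factor. The dendriform
  identities collect the terms in which \<open>x\<close>, \<open>y\<close>, \<open>z\<close>, \<open>t\<close>, respectively, is the argument acted on. A
  product \<open>\<cdot>\<close> is expanded, and a bracket is split into \<open>\<diamondop>\<close>-products, exactly when the argument acted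
  on may lie in either factor; elements that only act stay as they are.
\<close>

lemma horizontal_identity:
  assumes "x \<in> A" "y \<in> A" "z \<in> A" "t \<in> A"
  shows "\<alpha> \<langle>y, z\<rangle> \<cdot> \<alpha> (x \<cdot> t) + \<langle>\<langle>x, y\<rangle>, \<alpha> z\<rangle> \<cdot> \<alpha> (\<alpha> t)
      + \<alpha> (\<alpha> y) \<cdot> (\<langle>x, z\<rangle> \<cdot> \<alpha> t) - \<alpha> (\<alpha> x) \<cdot> (\<alpha> y \<cdot> (z \<cdot> t))
      + \<alpha> (\<alpha> z) \<cdot> (\<alpha> x \<cdot> (y \<cdot> t)) = 0"
    (is "?lhs = 0")
proof -
  note [simp] = assms closed
  have bracket_yz: "\<alpha> \<langle>y, z\<rangle> \<cdot> \<alpha> (x \<cdot> t) =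
      \<alpha> \<langle>y, z\<rangle> \<triangleleft> \<alpha> (x \<triangleleft> t) + \<alpha> \<langle>y, z\<rangle> \<triangleleft> \<alpha> (x \<triangleright> t)
      + \<alpha> (y \<diamondop> z) \<triangleright> \<alpha> (x \<cdot> t) - \<alpha> (z \<diamondop> y) \<triangleright> \<alpha> (x \<cdot> t)"
  proof -
    have "\<alpha> (x \<cdot> t) = \<alpha> (x \<triangleleft> t) + \<alpha> (x \<triangleright> t)"
      by (simp add: horizontal_def linear_on_add[OF linear_twist])
    then have "\<alpha> \<langle>y, z\<rangle> \<triangleleft> \<alpha> (x \<cdot> t) = \<alpha> \<langle>y, z\<rangle> \<triangleleft> \<alpha> (x \<triangleleft> t) + \<alpha> \<langle>y, z\<rangle> \<triangleleft> \<alpha> (x \<triangleright> t)"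
      by (simp add: products_add)
    moreover have "\<alpha> \<langle>y, z\<rangle> \<triangleright> \<alpha> (x \<cdot> t) = \<alpha> (y \<diamondop> z) \<triangleright> \<alpha> (x \<cdot> t) - \<alpha> (z \<diamondop> y) \<triangleright> \<alpha> (x \<cdot> t)"
      by (simp add: bracket_diamond linear_on_diff[OF linear_twist vector_space_on_carrier]
          products_diff)
    ultimately show ?thesis
      by (simp add: horizontal_def[of _ _ "\<alpha> \<langle>y, z\<rangle>"])
  qed
  have bracket_xyz: "\<langle>\<langle>x, y\<rangle>, \<alpha> z\<rangle> \<cdot> \<alpha> (\<alpha> t) =
      \<langle>\<langle>x, y\<rangle>, \<alpha> z\<rangle> \<triangleleft> \<alpha> (\<alpha> t) + (\<langle>x, y\<rangle> \<diamondop> \<alpha> z) \<triangleright> \<alpha> (\<alpha> t)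
      - (\<alpha> z \<diamondop> (x \<diamondop> y)) \<triangleright> \<alpha> (\<alpha> t) + (\<alpha> z \<diamondop> (y \<diamondop> x)) \<triangleright> \<alpha> (\<alpha> t)"
  proof -
    have "\<alpha> z \<diamondop> \<langle>x, y\<rangle> = \<alpha> z \<diamondop> (x \<diamondop> y) - \<alpha> z \<diamondop> (y \<diamondop> x)"
      by (simp add: bracket_diamond diamond_diff)
    then have "\<langle>\<langle>x, y\<rangle>, \<alpha> z\<rangle> \<triangleright> \<alpha> (\<alpha> t) =
        (\<langle>x, y\<rangle> \<diamondop> \<alpha> z) \<triangleright> \<alpha> (\<alpha> t)
        - ((\<alpha> z \<diamondop> (x \<diamondop> y)) \<triangleright> \<alpha> (\<alpha> t) - (\<alpha> z \<diamondop> (y \<diamondop> x)) \<triangleright> \<alpha> (\<alpha> t))"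
      by (simp add: bracket_diamond[of "\<langle>x, y\<rangle>"] products_diff)
    then show ?thesis
      by (simp add: horizontal_def[of _ _ "\<langle>\<langle>x, y\<rangle>, \<alpha> z\<rangle>"])
  qed
  have bracket_xz: "\<alpha> (\<alpha> y) \<cdot> (\<langle>x, z\<rangle> \<cdot> \<alpha> t) =
      \<alpha> (\<alpha> y) \<triangleright> (\<langle>x, z\<rangle> \<cdot> \<alpha> t) + \<alpha> (\<alpha> y) \<triangleleft> (\<langle>x, z\<rangle> \<triangleleft> \<alpha> t)
      + \<alpha> (\<alpha> y) \<triangleleft> ((x \<diamondop> z) \<triangleright> \<alpha> t) - \<alpha> (\<alpha> y) \<triangleleft> ((z \<diamondop> x) \<triangleright> \<alpha> t)"
  proof -
    have "\<langle>x, z\<rangle> \<cdot> \<alpha> t = \<langle>x, z\<rangle> \<triangleleft> \<alpha> t + ((x \<diamondop> z) \<triangleright> \<alpha> t - (z \<diamondop> x) \<triangleright> \<alpha> t)"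
      by (simp add: horizontal_def bracket_diamond products_diff)
    then have "\<alpha> (\<alpha> y) \<triangleleft> (\<langle>x, z\<rangle> \<cdot> \<alpha> t) =
        \<alpha> (\<alpha> y) \<triangleleft> (\<langle>x, z\<rangle> \<triangleleft> \<alpha> t)
        + (\<alpha> (\<alpha> y) \<triangleleft> ((x \<diamondop> z) \<triangleright> \<alpha> t) - \<alpha> (\<alpha> y) \<triangleleft> ((z \<diamondop> x) \<triangleright> \<alpha> t))"
      by (simp add: products_add products_diff)
    then show ?thesis
      by (simp add: horizontal_def[of _ _ "\<alpha> (\<alpha> y)"] algebra_simps)
  qed
  have triple: "u \<cdot> (v \<cdot> (w \<cdot> t)) =
      u \<triangleright> (v \<cdot> (w \<cdot> t)) + u \<triangleleft> (v \<triangleright> (w \<cdot> t)) + u \<triangleleft> (v \<triangleleft> (w \<triangleright> t)) + u \<triangleleft> (v \<triangleleft> (w \<triangleleft> t))"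
    if "u \<in> A" "v \<in> A" "w \<in> A" for u v w
    using that by (simp add: horizontal_def products_add algebra_simps)
  have triple_x: "\<alpha> (\<alpha> x) \<cdot> (\<alpha> y \<cdot> (z \<cdot> t)) =
      \<alpha> (\<alpha> x) \<triangleright> (\<alpha> y \<cdot> (z \<cdot> t)) + \<alpha> (\<alpha> x) \<triangleleft> (\<alpha> y \<triangleright> (z \<cdot> t))
      + \<alpha> (\<alpha> x) \<triangleleft> (\<alpha> y \<triangleleft> (z \<triangleright> t)) + \<alpha> (\<alpha> x) \<triangleleft> (\<alpha> y \<triangleleft> (z \<triangleleft> t))"
    and triple_z: "\<alpha> (\<alpha> z) \<cdot> (\<alpha> x \<cdot> (y \<cdot> t)) =
      \<alpha> (\<alpha> z) \<triangleright> (\<alpha> x \<cdot> (y \<cdot> t)) + \<alpha> (\<alpha> z) \<triangleleft> (\<alpha> x \<triangleright> (y \<cdot> t))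
      + \<alpha> (\<alpha> z) \<triangleleft> (\<alpha> x \<triangleleft> (y \<triangleright> t)) + \<alpha> (\<alpha> z) \<triangleleft> (\<alpha> x \<triangleleft> (y \<triangleleft> t))"
    by (intro triple; simp)+
  have "?lhs =
      ((\<alpha> z \<diamondop> (y \<diamondop> x)) \<triangleright> \<alpha> (\<alpha> t) - \<alpha> (\<alpha> x) \<triangleright> (\<alpha> y \<cdot> (z \<cdot> t))
        + \<alpha> (\<alpha> z) \<triangleleft> (\<alpha> x \<triangleright> (y \<cdot> t)) + \<alpha> \<langle>y, z\<rangle> \<triangleleft> \<alpha> (x \<triangleright> t)
        - \<alpha> (\<alpha> y) \<triangleleft> ((z \<diamondop> x) \<triangleright> \<alpha> t))
      + (\<alpha> (\<alpha> z) \<triangleleft> (\<alpha> x \<triangleleft> (y \<triangleright> t)) - (\<alpha> z \<diamondop> (x \<diamondop> y)) \<triangleright> \<alpha> (\<alpha> t)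
        - \<alpha> (\<alpha> x) \<triangleleft> (\<alpha> y \<triangleright> (z \<cdot> t)) - \<alpha> (z \<diamondop> y) \<triangleright> \<alpha> (x \<cdot> t)
        + \<alpha> (\<alpha> y) \<triangleright> (\<langle>x, z\<rangle> \<cdot> \<alpha> t))
      + (\<alpha> (\<alpha> z) \<triangleright> (\<alpha> x \<cdot> (y \<cdot> t)) + (\<langle>x, y\<rangle> \<diamondop> \<alpha> z) \<triangleright> \<alpha> (\<alpha> t)
        - \<alpha> (\<alpha> x) \<triangleleft> (\<alpha> y \<triangleleft> (z \<triangleright> t)) + \<alpha> (y \<diamondop> z) \<triangleright> \<alpha> (x \<cdot> t)
        + \<alpha> (\<alpha> y) \<triangleleft> ((x \<diamondop> z) \<triangleright> \<alpha> t))
      + (\<langle>\<langle>x, y\<rangle>, \<alpha> z\<rangle> \<triangleleft> \<alpha> (\<alpha> t) - \<alpha> (\<alpha> x) \<triangleleft> (\<alpha> y \<triangleleft> (z \<triangleleft> t))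
        + \<alpha> (\<alpha> z) \<triangleleft> (\<alpha> x \<triangleleft> (y \<triangleleft> t)) + \<alpha> \<langle>y, z\<rangle> \<triangleleft> \<alpha> (x \<triangleleft> t)
        + \<alpha> (\<alpha> y) \<triangleleft> (\<langle>x, z\<rangle> \<triangleleft> \<alpha> t))"
    unfolding bracket_yz bracket_xyz bracket_xz triple_x triple_z by (simp only: algebra_simps)
  also have "\<dots> = 0"
    by (simp only: M_dendriform1[OF assms] M_dendriform2[OF assms]
        M_dendriform3[OF assms] M_dendriform4[OF assms] add_0)
  finally show ?thesis .
qed

theorem hom_pre_malcev_horizontal: "hom_pre_malcev scale A (horizontal (\<triangleright>) (\<triangleleft>)) \<alpha>"
proof -
  have alg: "hom_algebra scale A (horizontal (\<triangleright>) (\<triangleleft>)) \<alpha>"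
    by unfold_locales (fact bilinear_horizontal linear_twist)+
  have "hom_algebra.bracket (horizontal (\<triangleright>) (\<triangleleft>)) x y = \<langle>x, y\<rangle>" for x y
    by (simp add: hom_algebra.bracket_def[OF alg] bracket_def)
  then show ?thesis
    using horizontal_identity
    by (intro hom_pre_malcev.intro[OF alg] hom_pre_malcev_axioms.intro) simp
qed

end

section \<open>Pushing a Hom-M-dendriform structure forward\<close>

text \<open>
  Identities survive surjective maps: every term of an identity in the image is the value
  of \<open>f\<close> at the same term in the source. The rules collected in \<open>push\<close> below therefore move \<open>f\<close> outwards.
\<close>

lemma hom_M_dendriform_image:
  assumes source: "hom_M_dendriform sA A rtA ltA \<alpha>"
    and "vector_space sB" and f: "linear_on sA A sB B f"
    and rt: "\<And>x y. x \<in> A \<Longrightarrow> y \<in> A \<Longrightarrow> rtB (f x) (f y) = f (rtA x y)"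
    and lt: "\<And>x y. x \<in> A \<Longrightarrow> y \<in> A \<Longrightarrow> ltB (f x) (f y) = f (ltA x y)"
    and twist: "\<And>x. x \<in> A \<Longrightarrow> \<beta> (f x) = f (\<alpha> x)"
  shows "hom_M_dendriform sB (f ` A) rtB ltB \<beta>"
proof -
  interpret src: hom_M_dendriform sA A rtA ltA \<alpha> by fact
  interpret tgt: two_products rtB ltB .
  note vs = src.vector_space_on_carrier
  note [simp] = src.closed
  have add: "f x + f y = f (x + y)" and diff: "f x - f y = f (x - y)"
    if "x \<in> A" "y \<in> A" for x y
    using that by (simp_all add: linear_on_add[OF f] linear_on_diff[OF f vs])
  have hor: "horizontal rtB ltB (f x) (f y) = f (horizontal rtA ltA x y)"
    if "x \<in> A" "y \<in> A" for x y
    using that by (simp add: horizontal_def rt lt add)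
  have dia: "tgt.diamond_mul (f x) (f y) = f (src.diamond_mul x y)" if "x \<in> A" "y \<in> A" for x y
    using that by (simp add: tgt.diamond_mul_def src.diamond_mul_def rt lt diff)
  have bra: "tgt.bracket (f x) (f y) = f (src.bracket x y)" if "x \<in> A" "y \<in> A" for x y
    using that by (simp add: tgt.bracket_def src.bracket_def hor diff)
  note push = add diff hor dia bra rt lt twist
  have zero: "f 0 = 0"
    using linear_on_zero[OF f] src.subspace_0[OF src.subspace_carrier] .
  interpret img: vector_space_on sB "f ` A"
    using linear_on_subspace_image[OF f vs] assms(2) .
  show ?thesis
  proof (unfold_locales, goal_cases)
    case 1 show ?case using bilinear_on_image[OF vs f src.bilinear_rt] rt by blast
  next
    case 2 show ?case using bilinear_on_image[OF vs f src.bilinear_lt] lt by blast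
  next
    case 3 show ?case using linear_on_image[OF vs f src.linear_twist] twist by blast
  next
    case (4 x y z t)
    then show ?case using src.M_dendriform1 zero by (auto simp: push)
  next
    case (5 x y z t)
    then show ?case using src.M_dendriform2 zero by (auto simp: push)
  next
    case (6 x y z t)
    then show ?case using src.M_dendriform3 zero by (auto simp: push)
  next
    case (7 x y z t)
    then show ?case using src.M_dendriform4 zero by (auto simp: push)
  qed
qed

section \<open>O-operators\<close>

context hom_O_operator
begin

abbreviation rtV  (infixl "\<triangleright>" 70) where "a \<triangleright> b \<equiv> r (T b) a"
abbreviation ltV  (infixl "\<triangleleft>" 70) where "a \<triangleleft> b \<equiv> l (T a) b"
abbreviation mulV where "mulV \<equiv> horizontal (\<triangleright>) (\<triangleleft>)"

lemma vector_space_on_V: "vector_space_on sV V"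
  by unfold_locales

lemma V_closed: "a \<in> V \<Longrightarrow> b \<in> V \<Longrightarrow> a + b \<in> V" "a \<in> V \<Longrightarrow> b \<in> V \<Longrightarrow> a - b \<in> V"
  using V.subspace_carrier by (auto intro: V.subspace_add V.subspace_diff)

lemmas T_closed = linear_on_closed[OF linear_T]
  and T_add = linear_on_add[OF linear_T]
  and T_diff = linear_on_diff[OF linear_T vector_space_on_V]

lemma action_closed: "x \<in> A \<Longrightarrow> a \<in> V \<Longrightarrow> l x a \<in> V" "x \<in> A \<Longrightarrow> a \<in> V \<Longrightarrow> r x a \<in> V"
  using bilinear_l bilinear_r by (auto simp: bilinear_on_def linear_on_def)

lemma action_zero: "a \<in> V \<Longrightarrow> l 0 a = 0" "a \<in> V \<Longrightarrow> r 0 a = 0"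
  using bilinear_l bilinear_r subspace_0[OF subspace_carrier]
  by (auto simp: bilinear_on_def intro: linear_on_zero[where f = "\<lambda>x. l x a"]
      linear_on_zero[where f = "\<lambda>x. r x a"])

lemma bilinear_rtV: "bilinear_on sV V sV V sV V (\<triangleright>)"
  and bilinear_ltV: "bilinear_on sV V sV V sV V (\<triangleleft>)"
  using bilinear_l bilinear_r linear_T by (auto simp: bilinear_on_def linear_on_def Pi_iff)

lemma T_horizontal: "a \<in> V \<Longrightarrow> b \<in> V \<Longrightarrow> T (mulV a b) = T a \<cdot> T b"
  by (simp add: horizontal_def T_mul)

text \<open>
  The rules \<open>tr\<close> below are the dictionary between products on \<open>V\<close> and actions of values of \<open>T\<close>. Each
  dendriform identity becomes the representation identity applied to the argument acted on, once
  compatibility with the twists has moved \<open>\<beta>\<close> inside the actions.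
\<close>

theorem hom_M_dendriform_V: "hom_M_dendriform sV V (\<triangleright>) (\<triangleleft>) \<beta>"
proof -
  interpret D: two_products "(\<triangleright>)" "(\<triangleleft>)" .
  note \<beta>_closed = linear_on_closed[OF linear_beta]
  note [simp] = T_closed V_closed action_closed \<beta>_closed T_twist
  have mulV_closed [simp]: "mulV a b \<in> V" if "a \<in> V" "b \<in> V" for a b
    using that by (simp add: horizontal_def)
  have dia: "D.diamond_mul a b = \<rho> (T a) b" for a b
    by (simp add: D.diamond_mul_def \<rho>_def)
  have [simp]: "D.bracket a b \<in> V" if "a \<in> V" "b \<in> V" for a b
    using that by (simp add: D.bracket_def)
  have bra: "T (D.bracket a b) = \<langle>T a, T b\<rangle>" if "a \<in> V" "b \<in> V" for a b
    using that by (simp add: D.bracket_def bracket_def T_diff T_horizontal)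
  note tr = dia bra T_horizontal
  have \<rho>_closed [simp]: "\<rho> x a \<in> V" if "x \<in> A" "a \<in> V" for x a
    using that by (simp add: \<rho>_def)
  have [simp]: "\<beta> (l x a) = l (\<alpha> x) (\<beta> a)" "\<beta> (r x a) = r (\<alpha> x) (\<beta> a)"
    "\<beta> (\<rho> x a) = \<rho> (\<alpha> x) (\<beta> a)"
    if "x \<in> A" "a \<in> V" for x a
    using that
    by (simp_all add: l_twist r_twist \<rho>_def linear_on_diff[OF linear_beta vector_space_on_V])
  \<comment> \<open>The representation identity for \<open>l\<close> and the last dendriform identity use opposite brackets.\<close>
  have l_bracket: "l (\<alpha> (\<alpha> (T y))) (l \<langle>T z, T x\<rangle> (\<beta> t))
      = - l (\<alpha> (\<alpha> (T y))) (l \<langle>T x, T z\<rangle> (\<beta> t))"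
    if "x \<in> V" "y \<in> V" "z \<in> V" "t \<in> V" for x y z t
  proof -
    have A: "\<langle>T x, T z\<rangle> \<in> A" "\<alpha> (\<alpha> (T y)) \<in> A"
      using that bra[of x z, symmetric] by (simp_all flip: T_twist)
    have lv: "linear_on sA A sV V (\<lambda>u. l u (\<beta> t))" and ly: "linear_on sV V sV V (l (\<alpha> (\<alpha> (T y))))"
      using that A(2) bilinear_l by (auto simp: bilinear_on_def)
    have "\<langle>T z, T x\<rangle> = 0 - \<langle>T x, T z\<rangle>"
      by (simp add: bracket_def)
    then have "l \<langle>T z, T x\<rangle> (\<beta> t) = 0 - l \<langle>T x, T z\<rangle> (\<beta> t)"
      using linear_on_diff[OF lv, of 0] vector_space_on_axioms A(1) subspace_0[OF subspace_carrier] that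
      by (simp add: action_zero)
    then show ?thesis
      using linear_on_diff[OF ly vector_space_on_V, of 0] A(1) that V.subspace_0[OF V.subspace_carrier]
      by (simp add: linear_on_zero[OF ly])
  qed
  show ?thesis
    apply unfold_locales
    subgoal by (fact bilinear_rtV)
    subgoal by (fact bilinear_ltV)
    subgoal by (fact linear_beta)
    subgoal for x y z t
      using representation_r1[of "T t" "T z" "T y" x] by (simp add: tr)
    subgoal for x y z t
      using representation_r2[of "T t" "T z" "T x" y] by (simp add: tr)
    subgoal for x y z t
      using representation_r3[of "T t" "T x" "T y" z] by (simp add: tr)
    subgoal for x y z t
      using representation_l[of "T x" "T y" "T z" t]
      by (simp add: tr l_bracket[of x y z t] algebra_simps)
    done
qed

text \<open>
  If \<open>T a = T a'\<close>, then \<open>T a \<cdot> T b = T a' \<cdot> T b\<close>. By the O-operator identity both sides are sums of two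
  terms, and the terms \<open>T (l (T a) b)\<close> and \<open>T (l (T a') b)\<close> agree, so the other two do as well.
\<close>

lemma T_rtV_cong:
  assumes "a \<in> V" "a' \<in> V" "b \<in> V" "T a = T a'"
  shows "T (a \<triangleright> b) = T (a' \<triangleright> b)"
proof -
  note [simp] = assms(1-3) T_closed action_closed
  have "T (l (T a) b) + T (a \<triangleright> b) = T (l (T a') b) + T (a' \<triangleright> b)"
    using T_mul[of a b] T_mul[of a' b] assms(4) by (simp add: T_add)
  then show ?thesis using assms(4) by simp
qed

lemma T_ltV_cong:
  assumes "a \<in> V" "b \<in> V" "b' \<in> V" "T b = T b'"
  shows "T (a \<triangleleft> b) = T (a \<triangleleft> b')"
proof -
  note [simp] = assms(1-3) T_closed action_closed
  have "T (a \<triangleleft> b) + T (r (T b) a) = T (a \<triangleleft> b') + T (r (T b') a)"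
    using T_mul[of a b] T_mul[of a b'] assms(4) by (simp add: T_add)
  then show ?thesis using assms(4) by simp
qed

text \<open>
  The products are computed at an arbitrary choice of preimages. Only the factor that is acted on
  needs one, since the action itself depends on a value of \<open>T\<close> only.
\<close>

lemma ex_image_products:
  obtains rtT ltT where
    "\<And>a b. a \<in> V \<Longrightarrow> b \<in> V \<Longrightarrow> rtT (T a) (T b) = T (a \<triangleright> b)"
    "\<And>a b. a \<in> V \<Longrightarrow> b \<in> V \<Longrightarrow> ltT (T a) (T b) = T (a \<triangleleft> b)"
proof -
  let ?s = "inv_into V T"
  have s: "?s (T a) \<in> V" "T (?s (T a)) = T a" if "a \<in> V" for a
    using that by (auto intro: inv_into_into f_inv_into_f)
  show thesis
  proof
    show "T (r (T b) (?s (T a))) = T (a \<triangleright> b)" if "a \<in> V" "b \<in> V" for a b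
      using that s by (intro T_rtV_cong) auto
    show "T (l (T a) (?s (T b))) = T (a \<triangleleft> b)" if "a \<in> V" "b \<in> V" for a b
      using that s by (intro T_ltV_cong) auto
  qed
qed

end

theorem proposition4p4:
  fixes sA :: "'k::field_char_0 \<Rightarrow> 'a::ab_group_add \<Rightarrow> 'a"
    and sV :: "'k \<Rightarrow> 'v::ab_group_add \<Rightarrow> 'v"
  assumes "hom_pre_malcev sA A mul \<alpha>"
    and "hom_pre_malcev_representation sA A mul \<alpha> sV V l r \<beta>"
    and "hom_O_operator sA A mul \<alpha> sV V l r \<beta> T"
  shows
    "let rtV = (\<lambda>a b. r (T b) a); ltV = (\<lambda>a b. l (T a) b); mulV = horizontal rtV ltV in
      hom_M_dendriform sV V rtV ltV \<beta> \<and>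
      hom_pre_malcev sV V mulV \<beta> \<and>
      hom_pre_malcev_morphism sV V mulV \<beta> sA A mul \<alpha> T \<and>
      hom_pre_malcev_subalgebra sA A mul \<alpha> (T ` V) \<and>
      (\<exists>rtT ltT.
        (\<forall>a\<in>V. \<forall>b\<in>V. rtT (T a) (T b) = T (rtV a b)) \<and>
        (\<forall>a\<in>V. \<forall>b\<in>V. ltT (T a) (T b) = T (ltV a b)) \<and>
        hom_M_dendriform sA (T ` V) rtT ltT \<alpha> \<and>
        hom_pre_malcev sA (T ` V) (horizontal rtT ltT) \<alpha> \<and>
        (\<forall>u\<in>T ` V. \<forall>v\<in>T ` V. horizontal rtT ltT u v = mul u v) \<and>
        hom_M_dendriform_morphism sV V rtV ltV \<beta> sA (T ` V) rtT ltT \<alpha> T)"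

proof -
  interpret hom_O_operator sA A mul \<alpha> sV V l r \<beta> T by fact
  interpret V: hom_M_dendriform sV V rtV ltV \<beta>
    by (fact hom_M_dendriform_V)
  interpret VM: hom_pre_malcev sV V mulV \<beta>
    by (fact V.hom_pre_malcev_horizontal)
  have morphism: "hom_pre_malcev_morphism sV V mulV \<beta> sA A mul \<alpha> T"
    by unfold_locales (auto simp: linear_T T_horizontal T_twist)
  interpret img: vector_space_on sA "T ` V"
    by (rule linear_on_subspace_image[OF linear_T vector_space_on_V vector_space_axioms])
  have sub: "hom_pre_malcev_subalgebra sA A mul \<alpha> (T ` V)"
  proof
    show "T ` V \<subseteq> A" using T_closed by blast
    show "subspace (T ` V)" by (fact img.subspace_carrier)
    show "mul u v \<in> T ` V" if "u \<in> T ` V" "v \<in> T ` V" for u v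
      using that V.products_closed(3) by (auto simp flip: T_horizontal)
    show "\<alpha> u \<in> T ` V" if "u \<in> T ` V" for u
      using that V.closed by (auto simp flip: T_twist)
  qed
  obtain rtT ltT
    where rtT: "\<And>a b. a \<in> V \<Longrightarrow> b \<in> V \<Longrightarrow> rtT (T a) (T b) = T (rtV a b)"
      and ltT: "\<And>a b. a \<in> V \<Longrightarrow> b \<in> V \<Longrightarrow> ltT (T a) (T b) = T (ltV a b)"
    by (rule ex_image_products) blast
  have dendT: "hom_M_dendriform sA (T ` V) rtT ltT \<alpha>"
    using hom_M_dendriform_image[OF hom_M_dendriform_V vector_space_axioms linear_T] rtT ltT T_twist
    by simp
  have horT: "horizontal rtT ltT u v = mul u v" if "u \<in> T ` V" "v \<in> T ` V" for u v
    using that V.products_closed by (auto simp: horizontal_def rtT ltT T_mul T_add)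
  have "hom_M_dendriform_morphism sV V rtV ltV \<beta> sA (T ` V) rtT ltT \<alpha> T"
    using linear_T
    by (intro hom_M_dendriform_morphism.intro hom_M_dendriform_morphism_axioms.intro
        hom_M_dendriform_V dendT) (auto simp: linear_on_def rtT ltT T_twist)
  then show ?thesis
    using hom_M_dendriform_V VM.hom_pre_malcev_axioms morphism sub rtT ltT dendT
      hom_M_dendriform.hom_pre_malcev_horizontal[OF dendT] horT
    unfolding Let_def by blast
qed

end
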